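(* Let $\bar A=\{A_1,\dots,A_{8g-4}\}$ be any partition with $A_i\in(P_i,Q_i)$ for every $i$. Then each partition point $A_i$, $1\le i\le 8g-4$, satisfies the cycle property: there exist positive integers $m_i,k_i$ such that \[ f_{\bar A}^{m_i}(T_iA_i)=f_{\bar A}^{k_i}(T_{i-1}A_i). \]
   Context: Setting. Fix $g\ge 2$. Work in the Poincaré unit disk $\mathbb D$ with hyperbolic metric $2|dz|/(1-|z|^2)$; let $\mathbb S$ be the unit circle. Let $\mathcal F$ be the regular hyperbolic $(8g-4)$-gon centered at $0$ with all interior angles equal to $\pi/2$; it is a fundamental domain (Adler–Flatto) of a cocompact torsion-free Fuchsian group $\Gamma$ of genus $g$. All indices are taken mod $8g-4$. Label the sides of $\mathcal F$ by $1,\dots,8g-4$ counterclockwise and the vertices $V_1,\dots,V_{8g-4}$ so that side $i$ joins $V_i$ to $V_{i+1}$. The complete geodesic extending side $i$ is oriented from its endpoint $P_i\in\mathbb S$ (beyond $V_i$) to its endpoint $Q_{i+1}\in\mathbb S$ (beyond $V_{i+1}$); the points on $\mathbb S$ are in the counterclockwise order $P_1,Q_1,P_2,Q_2,\dots,P_{8g-4},Q_{8g-4}$. Define $\sigma(i)=4g-i$ for odd $i$ and $\sigma(i)=2-i$ for even $i$ (mod $8g-4$), $\rho(i)=\sigma(i)+1$, $\theta(i)=\sigma(i)-1$. The generators $T_1,\dots,T_{8g-4}$ of $\Gamma$ are the Möbius transformations of $\mathbb D$ with $T_i$ mapping side $i$ onto side $\sigma(i)$, whose isometric circle is the geodesic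 $P_iQ_{i+1}$; $T_i$ maps the geodesic $P_iQ_{i+1}$ onto the geodesic $Q_{\sigma(i)+1}P_{\sigma(i)}$ (the isometric circle of $T_{\sigma(i)}$), the inside of the former to the outside of the latter, and $T_{\sigma(i)}T_i=\mathrm{Id}$, $T_i(V_i)=V_{\rho(i)}$, $T_{\rho^3(i)}T_{\rho^2(i)}T_{\rho(i)}T_i=\mathrm{Id}$. Notation: for $A,B\in\mathbb S$, $[A,B]$, $(A,B]$, $[A,B)$, $(A,B)$ denote arcs of $\mathbb S$ from $A$ to $B$ in the counterclockwise direction. Boundary map: for a partition $\bar A=\{A_1,\dots,A_{8g-4}\}$ with $A_i\in(P_i,Q_i)$, define $f_{\bar A}:\mathbb S\to\mathbb S$ by $f_{\bar A}(x)=T_i(x)$ if $x\in[A_i,A_{i+1})$. Convention for the orbits $\{f^n_{\bar A}(T_iA_i)\}$ and $\{f^n_{\bar A}(T_{i-1}A_i)\}$: if the orbit of $T_{i-1}A_i$ hits a discontinuity point $A_j$, the next iterate is $T_{j-1}A_j$; if the orbit of $T_iA_i$ hits $A_j$, the next iterate is $T_jA_j$. *)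

theory Defs
  imports "HOL-Analysis.Analysis"
begin

(* Number of sides: N = 8g - 4.  Indices are integers, taken mod N. *)
definition NN :: "nat \<Rightarrow> int" where
  "NN g = 8 * int g - 4"

definition sig :: "nat \<Rightarrow> int \<Rightarrow> int" where
  "sig g i = (if odd i then 4 * int g - i else 2 - i) mod NN g"

definition rho :: "nat \<Rightarrow> int \<Rightarrow> int" where
  "rho g i = (sig g i + 1) mod NN g"

definition theta :: "nat \<Rightarrow> int \<Rightarrow> int" where
  "theta g i = (sig g i - 1) mod NN g"

(* Geometry of the regular N-gon with interior angles pi/2 centered at 0.
   Side i lies on the geodesic (circle orthogonal to the unit circle) whose
   Euclidean centre is at direction 2*pi*i/N and distance 1/sqrt(cos(2pi/N)).
   Its endpoints on the unit circle are at angles 2*pi*i/N -+ beta,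
   where cos beta = sqrt(cos(2pi/N)). *)
definition cc :: "nat \<Rightarrow> real" where
  "cc g = cos (2 * pi / real_of_int (NN g))"

definition beta :: "nat \<Rightarrow> real" where
  "beta g = arccos (sqrt (cc g))"

(* P_i: endpoint of geodesic of side i beyond V_i;
   Q_(i+1): endpoint of geodesic of side i beyond V_(i+1). *)
definition Pt :: "nat \<Rightarrow> int \<Rightarrow> complex" where
  "Pt g i = cis (2 * pi * real_of_int i / real_of_int (NN g) - beta g)"

definition Qt :: "nat \<Rightarrow> int \<Rightarrow> complex" where
  "Qt g i = cis (2 * pi * real_of_int (i - 1) / real_of_int (NN g) + beta g)"

(* hyperbolic midpoint of side i (point of side i closest to 0) *)
definition mid_rad :: "nat \<Rightarrow> real" where
  "mid_rad g = (1 - sqrt (1 - cc g)) / sqrt (cc g)"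

definition Mid :: "nat \<Rightarrow> int \<Rightarrow> complex" where
  "Mid g i = complex_of_real (mid_rad g) * cis (2 * pi * real_of_int i / real_of_int (NN g))"

definition invol :: "complex \<Rightarrow> complex \<Rightarrow> complex" where
  "invol m z = (m - z) / (1 - cnj m * z)"

definition halfturn :: "complex \<Rightarrow> complex \<Rightarrow> complex" where
  "halfturn m z = invol m (- invol m z)"

(* Generator T_i: half-turn about the midpoint of side i followed by the
   rotation about 0 carrying side i to side sigma(i).  This is the unique
   orientation preserving isometry with T_i(V_i) = V_rho(i),
   T_i(V_(i+1)) = V_sigma(i); it maps P_i to Q_(sigma(i)+1) and
   Q_(i+1) to P_sigma(i).  As a Moebius map it also acts on the unit circle. *)
definition Tgen :: "nat \<Rightarrow> int \<Rightarrow> complex \<Rightarrow> complex" where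
  "Tgen g i z = cis (2 * pi * real_of_int (sig g i - i) / real_of_int (NN g)) * halfturn (Mid g i) z"

definition arc_co :: "complex \<Rightarrow> complex \<Rightarrow> complex set" where
  "arc_co a b = {x. \<exists>s t. 0 \<le> t \<and> t < s \<and> s \<le> 2 * pi \<and> x = a * cis t \<and> b = a * cis s}"

definition arc_oc :: "complex \<Rightarrow> complex \<Rightarrow> complex set" where
  "arc_oc a b = {x. \<exists>s t. 0 < t \<and> t \<le> s \<and> s \<le> 2 * pi \<and> x = a * cis t \<and> b = a * cis s}"

definition arc_oo :: "complex \<Rightarrow> complex \<Rightarrow> complex set" where
  "arc_oo a b = {x. \<exists>s t. 0 < t \<and> t < s \<and> s \<le> 2 * pi \<and> x = a * cis t \<and> b = a * cis s}"

definition fmap :: "nat \<Rightarrow> (int \<Rightarrow> complex) \<Rightarrow> complex \<Rightarrow> complex" where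
  "fmap g A x = Tgen g (THE i. 0 \<le> i \<and> i < NN g \<and> x \<in> arc_co (A i) (A (i + 1))) x"

(* Map used for the orbit of T_(i-1) A_i under the stated convention:
   identical to f_A except that a discontinuity point A_j is sent to
   T_(j-1) A_j, i.e. x in (A_i, A_(i+1)] is sent to T_i x. *)
definition fmap_lower :: "nat \<Rightarrow> (int \<Rightarrow> complex) \<Rightarrow> complex \<Rightarrow> complex" where
  "fmap_lower g A x = Tgen g (THE i. 0 \<le> i \<and> i < NN g \<and> x \<in> arc_oc (A i) (A (i + 1))) x"

end

theory Submission
  imports Defs "HOL-Number_Theory.Cong"
begin

text \<open>
  Write \<open>\<omega> = 2\<pi>/N\<close> and follow the two orbits of \<open>A\<^sub>i\<close> through pairs \<open>(T\<^sub>k x, T\<^bsub>k-1\<^esub> x)\<close> with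
  \<open>x \<in> (P\<^sub>k, Q\<^sub>k)\<close>, starting from \<open>x = A\<^sub>i\<close>. The vertex relation is
  \<open>T\<^bsub>\<rho>(k)\<^esub> T\<^sub>k = T\<^bsub>\<theta>(k-1)\<^esub> T\<^bsub>k-1\<^esub>\<close>, so the orbits merge at the next step
  unless \<open>T\<^sub>k x\<close> has passed the partition point \<open>A\<^bsub>\<sigma>(k)+2\<^esub>\<close> (``right'') or \<open>T\<^bsub>k-1\<^esub> x\<close> has not passed
  \<open>A\<^bsub>\<sigma>(k-1)-1\<^esub>\<close> (``left''). A right step forces \<open>x\<close> into the right half of \<open>(P\<^sub>k, Q\<^sub>k)\<close>
  and a left step into the left half, so they exclude each other; and after either the next images
  are again a pair of the same kind, at index \<open>r k = \<sigma>(k) + 2\<close> or \<open>l k = \<sigma>(k-1) - 1\<close>.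

  Relative to the arc \<open>(P\<^sub>k, Q\<^sub>k)\<close>, right steps move the point to the left and left steps to the
  right. Since \<open>r\<close> is an involution, two right steps return to the index \<open>k\<close>; if they come
  at the start or after a left step, this contradicts \<open>x \<le> A\<^sub>k\<close>. Hence right and left
  steps alternate. But \<open>l\<close> and \<open>r\<close> act on each residue class mod 4 of indices as
  reflections generating a dihedral group of a cycle of odd length \<open>2g-1\<close>, so some index is
  reached both before a right and before a left step, which would put \<open>A\<^sub>k\<close> in both halves of its arc.
\<close>

section \<open>Arcs of the unit circle in terms of angles\<close>

lemma cis_eq_iff: "cis a = cis b \<longleftrightarrow> (\<exists>n::int. a = b + 2 * pi * of_int n)"
proof
  assume "cis a = cis b"
  then have "sin a = sin b \<and> cos a = cos b" by (simp add: complex_eq_iff)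
  then show "\<exists>n::int. a = b + 2 * pi * of_int n"
    by (subst (asm) sin_cos_eq_iff) (auto simp: algebra_simps)
next
  assume "\<exists>n::int. a = b + 2 * pi * of_int n"
  then show "cis a = cis b" by (auto simp flip: cis_mult)
qed

text \<open>Recovers the arc length \<open>s\<close> hidden in the arc definitions. These allow
  \<open>s = 2 * pi\<close>, hence the weak bound on \<open>a\<close>.\<close>

lemma cis_shift_unique:
  assumes "cis a = cis b" "0 < a" "a \<le> 2 * pi" "0 < b" "b < 2 * pi"
  shows "a = b"
proof -
  obtain n :: int where n: "a = b + 2 * pi * of_int n" using assms(1) cis_eq_iff by auto
  have "2 * pi * of_int n < 2 * pi * 1" "2 * pi * (-1) < 2 * pi * of_int n"
    using n assms by linarith+
  then have "of_int n < (1::real)" "(-1::real) < of_int n"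
    using mult_left_less_imp_less[of "2 * pi"] by (blast intro: pi_ge_zero mult_nonneg_nonneg zero_le_numeral)+
  then have "n = 0" by linarith
  then show ?thesis using n by simp
qed

lemma arc_co_cis_iff:
  assumes "a < b" "b < a + 2 * pi"
  shows "cis x \<in> arc_co (cis a) (cis b) \<longleftrightarrow>
    (\<exists>n::int. a \<le> x + 2 * pi * of_int n \<and> x + 2 * pi * of_int n < b)"
proof
  assume "cis x \<in> arc_co (cis a) (cis b)"
  then obtain s t where st: "0 \<le> t" "t < s" "s \<le> 2 * pi" "cis x = cis (a + t)" "cis b = cis (a + s)"
    by (auto simp: arc_co_def cis_mult)
  have "cis (b - a) = cis s" using st(5)
    by (metis add_diff_cancel_left' cis_divide)
  then have "s = b - a" using st assms by (intro cis_shift_unique) auto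
  moreover obtain n :: int where "a + t = x + 2 * pi * of_int n" using st(4) cis_eq_iff by metis
  ultimately show "\<exists>n::int. a \<le> x + 2 * pi * of_int n \<and> x + 2 * pi * of_int n < b"
    using st by (intro exI[of _ n]) auto
next
  assume "\<exists>n::int. a \<le> x + 2 * pi * of_int n \<and> x + 2 * pi * of_int n < b"
  then obtain n :: int where n: "a \<le> x + 2 * pi * of_int n" "x + 2 * pi * of_int n < b" by auto
  have "cis x = cis (x + 2 * pi * of_int n)" by (simp flip: cis_mult)
  then show "cis x \<in> arc_co (cis a) (cis b)"
    unfolding arc_co_def cis_mult using n assms
    by (intro CollectI exI[of _ "b - a"] exI[of _ "x + 2 * pi * of_int n - a"]) auto
qed

lemma arc_oc_cis_iff:
  assumes "a < b" "b < a + 2 * pi"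
  shows "cis x \<in> arc_oc (cis a) (cis b) \<longleftrightarrow>
    (\<exists>n::int. a < x + 2 * pi * of_int n \<and> x + 2 * pi * of_int n \<le> b)"
proof
  assume "cis x \<in> arc_oc (cis a) (cis b)"
  then obtain s t where st: "0 < t" "t \<le> s" "s \<le> 2 * pi" "cis x = cis (a + t)" "cis b = cis (a + s)"
    by (auto simp: arc_oc_def cis_mult)
  have "cis (b - a) = cis s" using st(5)
    by (metis add_diff_cancel_left' cis_divide)
  then have "s = b - a" using st assms by (intro cis_shift_unique) auto
  moreover obtain n :: int where "a + t = x + 2 * pi * of_int n" using st(4) cis_eq_iff by metis
  ultimately show "\<exists>n::int. a < x + 2 * pi * of_int n \<and> x + 2 * pi * of_int n \<le> b"
    using st by (intro exI[of _ n]) auto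
next
  assume "\<exists>n::int. a < x + 2 * pi * of_int n \<and> x + 2 * pi * of_int n \<le> b"
  then obtain n :: int where n: "a < x + 2 * pi * of_int n" "x + 2 * pi * of_int n \<le> b" by auto
  have "cis x = cis (x + 2 * pi * of_int n)" by (simp flip: cis_mult)
  then show "cis x \<in> arc_oc (cis a) (cis b)"
    unfolding arc_oc_def cis_mult using n assms
    by (intro CollectI exI[of _ "b - a"] exI[of _ "x + 2 * pi * of_int n - a"]) auto
qed

lemma arc_oo_cisD:
  assumes "z \<in> arc_oo (cis a) (cis b)" "a < b" "b < a + 2 * pi"
  shows "\<exists>x. a < x \<and> x < b \<and> z = cis x"
proof -
  from assms(1) obtain s t where st: "0 < t" "t < s" "s \<le> 2 * pi" "z = cis (a + t)" "cis b = cis (a + s)"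
    by (auto simp: arc_oo_def cis_mult)
  have "cis (b - a) = cis s" using st(5)
    by (metis add_diff_cancel_left' cis_divide)
  then have "s = b - a" using st assms by (intro cis_shift_unique) auto
  then show ?thesis using st by (intro exI[of _ "a + t"]) auto
qed

text \<open>With \<open>q = tan y\<close>, cross-multiplication leaves
  \<open>q ^ 3 * (5 + q\<^sup>2) \<ge> 0\<close>. Used in \<open>eta_half_omega\<close> with
  \<open>y = \<omega> / 8\<close>; the factor 3/2 is the limit of the quotient of the tangents at
  0.\<close>

lemma tan_three_halves:
  fixes y :: real assumes "0 < y" "y < pi / 6" shows "3 / 2 * tan (2 * y) \<le> tan (3 * y)"
proof -
  define q where "q = tan y"
  have q: "0 < q" unfolding q_def using assms by (intro tan_gt_zero) auto
  have cs: "cos y > 0" "cos (2 * y) > 0" "cos (3 * y) > 0" using assms by (auto intro!: cos_gt_zero)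
  have "tan y < tan (pi / 6)" using assms by (intro tan_monotone) auto
  then have "q < 1 / sqrt 3" by (simp add: q_def tan_30)
  then have "q * q < 1 / sqrt 3 * (1 / sqrt 3)" using q by (intro mult_strict_mono) auto
  then have q3: "3 * q\<^sup>2 < 1" by (simp add: power2_eq_square)
  have t2: "tan (2 * y) = 2 * q / (1 - q\<^sup>2)"
    using tan_double[of y] cs by (simp add: q_def)
  have "tan (3 * y) = tan (2 * y + y)" by (simp add: algebra_simps)
  also have "\<dots> = (tan (2 * y) + q) / (1 - tan (2 * y) * q)"
    unfolding q_def using cs by (intro tan_add) (auto simp: algebra_simps)
  also have "\<dots> = (3 * q - q ^ 3) / (1 - 3 * q\<^sup>2)"
  proof -
    have n: "1 - q\<^sup>2 \<noteq> 0" using q3 zero_le_power2[of q] by linarith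
    have "1 - tan (2 * y) * q = (1 - 3 * q\<^sup>2) / (1 - q\<^sup>2)"
      unfolding t2 using n by (simp add: field_simps power2_eq_square)
    moreover have "tan (2 * y) + q = (3 * q - q ^ 3) / (1 - q\<^sup>2)"
      unfolding t2 using n by (simp add: field_simps power2_eq_square power3_eq_cube)
    ultimately show ?thesis using n by simp
  qed
  also have "\<dots> \<ge> 3 / 2 * (2 * q / (1 - q\<^sup>2))"
  proof -
    have p: "0 < 1 - 3 * q\<^sup>2" "0 < 1 - q\<^sup>2" using q3 zero_le_power2[of q] by linarith+
    have "(3 * q - q ^ 3) * (1 - q\<^sup>2) - 3 * q * (1 - 3 * q\<^sup>2) = q ^ 3 * (5 + q\<^sup>2)"
      by (simp add: algebra_simps power2_eq_square power3_eq_cube)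
    moreover have "\<dots> \<ge> 0" using q by simp
    ultimately have "3 * q * (1 - 3 * q\<^sup>2) \<le> (3 * q - q ^ 3) * (1 - q\<^sup>2)" by linarith
    then show ?thesis using p by (simp add: divide_simps mult.commute)
  qed
  finally show ?thesis unfolding t2 .
qed

section \<open>Angles of the regular polygon\<close>

locale regular_polygon =
  fixes g :: nat
  assumes genus: "g \<ge> 2"
begin

abbreviation N :: int where "N \<equiv> NN g"

abbreviation b :: real where "b \<equiv> beta g"

definition \<omega> :: real where "\<omega> = 2 * pi / real_of_int N"

definition c :: real where "c = sqrt (cc g)"

lemma N_ge: "N \<ge> 12" and even_N: "even N"
  using genus by (auto simp: NN_def)

lemma N_omega: "real_of_int N * \<omega> = 2 * pi"
  using N_ge by (simp add: \<omega>_def)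

lemma omega_pos: "0 < \<omega>" and omega_le: "\<omega> \<le> pi / 6"
proof -
  have "12 \<le> real_of_int N" using N_ge by linarith
  then show "0 < \<omega>" "\<omega> \<le> pi / 6" by (auto simp: \<omega>_def field_simps)
qed

lemma cos_omega: "cos \<omega> = 2 * (cos (\<omega> / 2))\<^sup>2 - 1"
  using cos_double_cos[of "\<omega> / 2"] by simp

text \<open>A crude bound suffices: for \<open>C = cos (\<omega> / 2)\<close>, \<open>b_le\<close>
  needs \<open>4 * C\<^sup>2 \<ge> 3\<close> and \<open>eta_half_omega\<close> needs
  \<open>17 * C > 13\<close>.\<close>

lemma cos_half_omega_ge: "cos (\<omega> / 2) \<ge> 9 / 10"
proof -
  have "(cos (\<omega> / 2))\<^sup>2 \<ge> (9/10)\<^sup>2"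
  proof -
    have "cos \<omega> \<ge> cos (pi / 6)"
      using omega_pos omega_le by (intro cos_monotone_0_pi_le) auto
    moreover have "sqrt 3 \<ge> 1.7" by (rule real_le_rsqrt) (simp add: power2_eq_square)
    ultimately show ?thesis unfolding cos_omega by (simp add: cos_30 power2_eq_square)
  qed
  moreover have "cos (\<omega> / 2) > 0" using omega_pos omega_le by (intro cos_gt_zero) auto
  ultimately show ?thesis using power2_le_imp_le by (metis less_eq_real_def)
qed

lemma cos_half_omega_lt: "cos (\<omega> / 2) < 1"
  using cos_monotone_0_pi[of 0 "\<omega> / 2"] omega_pos omega_le by simp

lemma cos_omega_bounds: "1/2 < cos \<omega>" "cos \<omega> < 1"
proof -
  have "(9/10)\<^sup>2 \<le> (cos (\<omega> / 2))\<^sup>2" using cos_half_omega_ge by (intro power_mono) auto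
  then show "1/2 < cos \<omega>" unfolding cos_omega by (simp add: power2_eq_square)
  show "cos \<omega> < 1" using cos_monotone_0_pi[of 0 \<omega>] omega_pos omega_le by simp
qed

lemma c_sq: "c\<^sup>2 = cos \<omega>"
  using cos_omega_bounds by (simp add: c_def cc_def \<omega>_def)

lemma c_pos: "0 < c" and c_less_1: "c < 1"
  using cos_omega_bounds by (auto simp: c_def cc_def \<omega>_def)

lemma cos_b: "cos b = c"
  using c_pos c_less_1 by (simp add: beta_def c_def[symmetric])

lemma b_pos: "0 < b" and b_less_pi: "b < pi"
proof -
  have "0 \<le> b" "b \<le> pi" unfolding beta_def c_def[symmetric]
    using c_pos c_less_1 by (auto intro: arccos_lbound arccos_ubound)
  moreover have "b \<noteq> 0" "b \<noteq> pi" using cos_b c_pos c_less_1 by auto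
  ultimately show "0 < b" "b < pi" by auto
qed

text \<open>Relative to direction \<open>i * \<omega>\<close>, the points P_i and Q_i have angles
  \<open>- b\<close> and \<open>b - \<omega>\<close>, so this gives the arc (P_i, Q_i) positive
  length. Its counterpart \<open>b_less_omega\<close> separates consecutive arcs.\<close>

lemma half_omega_less_b: "\<omega> / 2 < b"
proof -
  have "c\<^sup>2 < (cos (\<omega> / 2))\<^sup>2"
    using power_strict_mono[OF cos_half_omega_lt, of 2] cos_half_omega_ge
    unfolding c_sq cos_omega by simp
  then have "c < cos (\<omega> / 2)"
    by (rule power2_less_imp_less) (use cos_half_omega_ge in auto)
  then show ?thesis unfolding cos_b[symmetric]
    using b_pos b_less_pi omega_pos omega_le by (subst (asm) cos_mono_less_eq) auto
qed

text \<open>Comparing squared cosines leaves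
  \<open>(1 - C) * (4 * C\<^sup>2 - 3) \<ge> 0\<close>.\<close>

lemma b_le: "b \<le> 3 * \<omega> / 4"
proof -
  define C where "C = cos (\<omega> / 2)"
  have C: "9/10 \<le> C" "C < 1" using cos_half_omega_ge cos_half_omega_lt by (auto simp: C_def)
  have C2: "C * C \<ge> 9/10 * (9/10)" using C by (intro mult_mono) auto
  have "2 * (cos (3 * \<omega> / 4))\<^sup>2 = 1 + cos (3 * (\<omega> / 2))"
    using cos_double_cos[of "3 * \<omega> / 4"] by simp
  also have "\<dots> = 1 + 4 * C ^ 3 - 3 * C"
    unfolding cos_treble_cos C_def by simp
  also have "\<dots> \<le> 2 * (2 * C\<^sup>2 - 1)"
  proof -
    have "(1 - C) * (4 * (C * C) - 3) \<ge> 0" using C C2 by (intro mult_nonneg_nonneg) linarith+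
    then show ?thesis by (simp add: algebra_simps power2_eq_square power3_eq_cube)
  qed
  finally have "(cos (3 * \<omega> / 4))\<^sup>2 \<le> c\<^sup>2" unfolding c_sq cos_omega C_def by simp
  then have "cos (3 * \<omega> / 4) \<le> cos b" unfolding cos_b by (rule power2_le_imp_le) (use c_pos in auto)
  then show ?thesis
    using b_pos b_less_pi omega_pos omega_le by (subst (asm) cos_mono_le_eq) auto
qed

lemma b_less_omega: "b < \<omega>"
  using b_le omega_pos by linarith

section \<open>The generators as rotations of one Moebius map\<close>

text \<open>The half-turn about the midpoint of side 0: the midpoint \<open>m\<close> satisfies \<open>2m / (1 + m\<^sup>2) = c\<close>.\<close>

definition h :: "complex \<Rightarrow> complex" where "h z = (of_real c - z) / (1 - of_real c * z)"

lemma one_minus_c_mult_nonzero: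
  fixes z :: complex
  shows "norm z = 1 \<Longrightarrow> 1 - of_real c * z \<noteq> 0"
proof
  assume "norm z = 1" "1 - of_real c * z = 0"
  then have "norm (of_real c * z) = 1" by simp
  then show False using \<open>norm z = 1\<close> c_pos c_less_1 by (simp add: norm_mult)
qed

lemma norm_h: assumes "norm z = 1" shows "norm (h z) = 1"
proof -
  have "z * cnj z = 1" using assms by (simp add: complex_norm_square[symmetric])
  then have "of_real c - z = - z * cnj (1 - of_real c * z)" by (simp add: algebra_simps)
  then have "norm (of_real c - z) = norm (1 - of_real c * z)"
    using assms by (metis complex_mod_cnj mult_1 norm_minus_cancel norm_mult)
  then show ?thesis
    using one_minus_c_mult_nonzero[OF assms] by (simp add: h_def norm_divide)
qed

text \<open>\<open>sig\<close> without the reduction mod \<open>N\<close>, which makes \<open>r\<close> and \<open>l\<close> below involutions on all integers.\<close>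

definition sg :: "int \<Rightarrow> int" where "sg i = (if odd i then 4 * int g - i else 2 - i)"

lemma sig_eq: "sig g i = sg i mod N"
  by (simp add: sig_def sg_def)

lemma cis_cong: "[i = j] (mod N) \<Longrightarrow> cis (of_int i * \<omega> + x) = cis (of_int j * \<omega> + x)"
proof -
  assume "[i = j] (mod N)"
  then obtain n where n: "i = j + N * n" by (metis cong_iff_lin cong_sym)
  have "of_int i * \<omega> + x = of_int j * \<omega> + x + (real_of_int N * \<omega>) * of_int n"
    unfolding n by (simp add: algebra_simps)
  then show ?thesis unfolding N_omega cis_eq_iff by blast
qed

lemma mid_rad: "0 < mid_rad g" "mid_rad g < 1" "2 * mid_rad g = c * (1 + (mid_rad g)\<^sup>2)"
proof -
  define d where "d = sqrt (1 - c\<^sup>2)"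
  have c1: "c\<^sup>2 < 1" using c_sq cos_omega_bounds by simp
  then have d: "d\<^sup>2 = 1 - c\<^sup>2" "0 < d" by (auto simp: d_def)
  have m: "mid_rad g = (1 - d) / c"
    using cos_omega_bounds by (simp add: mid_rad_def d_def c_def cc_def \<omega>_def)
  have "d < 1" using d c_pos by (simp add: d_def)
  then show "0 < mid_rad g" unfolding m using c_pos by simp
  have "(1 - c)\<^sup>2 < d\<^sup>2"
  proof -
    have "c * c < c * 1" using c_pos c_less_1 by (intro mult_strict_left_mono) auto
    then show ?thesis unfolding d by (simp add: power2_eq_square algebra_simps)
  qed
  then have "1 - c < d" by (rule power2_less_imp_less) (use d in auto)
  then show "mid_rad g < 1" unfolding m using c_pos by simp
  have "c\<^sup>2 + (1 - d)\<^sup>2 = 2 * (1 - d)" using d by (simp add: power2_eq_square algebra_simps)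
  then have "(c\<^sup>2 + (1 - d)\<^sup>2) / c = 2 * ((1 - d) / c)" by simp
  then show "2 * mid_rad g = c * (1 + (mid_rad g)\<^sup>2)"
    unfolding m using c_pos by (simp add: field_simps power2_eq_square)
qed

text \<open>By \<open>2 * m = c * (1 + m\<^sup>2)\<close>, numerator and denominator of the composed
  involutions share the factor \<open>(1 + m\<^sup>2) / (1 - m * w)\<close>; cancelling it leaves
  \<open>h\<close>.\<close>

lemma halfturn_rotated:
  assumes "norm w = 1" "norm u = 1"
  shows "halfturn (of_real (mid_rad g) * u) (u * w) = u * h w"
proof -
  define m where "m = complex_of_real (mid_rad g)"
  have u: "cnj u * u = 1"
    using assms(2) by (simp add: complex_norm_square[symmetric] mult.commute)
  have "norm (m * w) < 1" using assms mid_rad by (simp add: m_def norm_mult)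
  then have nz1: "1 - m * w \<noteq> 0" by auto
  have m2: "2 * m = of_real c * (1 + m\<^sup>2)"
    using mid_rad(3) unfolding m_def by (metis of_real_1 of_real_add of_real_mult of_real_numeral of_real_power)
  have nz2: "1 + m\<^sup>2 \<noteq> 0"
  proof -
    have "1 + (mid_rad g)\<^sup>2 \<noteq> 0" by (smt (verit) zero_le_power2)
    then show ?thesis unfolding m_def by (metis of_real_1 of_real_add of_real_eq_0_iff of_real_power)
  qed
  have inv: "invol (m * u) (u * v) = u * ((m - v) / (1 - m * v))" for v
  proof -
    have "cnj (m * u) * (u * v) = m * v * (cnj u * u)" by (simp add: m_def)
    then have "cnj (m * u) * (u * v) = m * v" unfolding u by simp
    moreover have "m * u - u * v = u * (m - v)" by (simp add: algebra_simps)
    ultimately show ?thesis unfolding invol_def by simp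
  qed
  have "halfturn (m * u) (u * w) = invol (m * u) (u * (- ((m - w) / (1 - m * w))))"
    unfolding halfturn_def inv[of w] by simp
  also have "\<dots> = u * ((m + (m - w) / (1 - m * w)) / (1 + m * ((m - w) / (1 - m * w))))"
    unfolding inv by simp
  also have "m + (m - w) / (1 - m * w) = (1 + m\<^sup>2) * (of_real c - w) / (1 - m * w)"
  proof -
    have "m * (1 - m * w) + (m - w) = 2 * m - w * (1 + m\<^sup>2)"
      by (simp add: algebra_simps power2_eq_square)
    also have "\<dots> = (1 + m\<^sup>2) * (of_real c - w)" unfolding m2 by (simp add: algebra_simps)
    finally show ?thesis using nz1 by (simp add: divide_simps)
  qed
  also have "1 + m * ((m - w) / (1 - m * w)) = (1 + m\<^sup>2) * (1 - of_real c * w) / (1 - m * w)"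
  proof -
    have "(1 - m * w) + m * (m - w) = (1 + m\<^sup>2) - w * (2 * m)"
      by (simp add: algebra_simps power2_eq_square)
    also have "\<dots> = (1 + m\<^sup>2) * (1 - of_real c * w)" unfolding m2 by (simp add: algebra_simps)
    finally show ?thesis using nz1 by (simp add: divide_simps)
  qed
  finally show ?thesis unfolding m_def[symmetric] h_def using nz1 nz2 by simp
qed

text \<open>In coordinates centred at its own side, every generator is \<open>h\<close> followed by
  a rotation, so all estimates concern a single map.\<close>

lemma Tgen_rotated:
  assumes "norm w = 1"
  shows "Tgen g i (cis (of_int i * \<omega>) * w) = cis (of_int (sg i) * \<omega>) * h w"
proof -
  have e: "2 * pi * real_of_int j / real_of_int N = of_int j * \<omega>" for j
    by (simp add: \<omega>_def)
  have "Tgen g i (cis (of_int i * \<omega>) * w)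
      = cis (of_int (sig g i - i) * \<omega>) * (cis (of_int i * \<omega>) * h w)"
    unfolding Tgen_def Mid_def e using assms by (simp add: halfturn_rotated)
  also have "\<dots> = cis (of_int (sig g i) * \<omega>) * h w"
    by (simp add: mult.assoc[symmetric] cis_mult algebra_simps)
  also have "cis (of_int (sig g i) * \<omega>) = cis (of_int (sg i) * \<omega>)"
    using cis_cong[of "sig g i" "sg i" 0] by (simp add: sig_eq cong_def)
  finally show ?thesis .
qed

lemma Tgen_cong:
  assumes "[i = j] (mod N)" shows "Tgen g i = Tgen g j"
proof -
  obtain n where n: "i = j + N * n" using assms by (metis cong_iff_lin cong_sym)
  \<comment> \<open>Parity survives reduction because \<open>N\<close> is even, so both indices take
    the same branch of \<open>sg\<close>.\<close>
  have "odd i = odd j" unfolding n using even_N by simp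
  then have "[sg i = sg j] (mod N)"
    unfolding sg_def using assms by (auto intro: cong_diff)
  then have s: "sig g i = sig g j" by (simp add: sig_eq cong_def)
  have e: "2 * pi * real_of_int k / real_of_int N = of_int k * \<omega>" for k
    by (simp add: \<omega>_def)
  have "Mid g i = Mid g j" unfolding Mid_def e using cis_cong[OF assms, of 0] by simp
  moreover have "cis (of_int (sig g i - i) * \<omega>) = cis (of_int (sig g j - j) * \<omega>)"
    using cis_cong[OF cong_diff[OF cong_refl assms, of "sig g j"], of 0] s by simp
  ultimately show ?thesis unfolding Tgen_def e by (intro ext) simp
qed

text \<open>With \<open>R\<close> the rotation by \<open>\<omega>\<close>, this says that \<open>R h\<close>, a quarter turn about a vertex, has order 4.
  It is equivalent to \<open>c\<^sup>2 = cos \<omega>\<close>.\<close>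

lemma h_relation:
  assumes "norm z = 1"
  shows "h (cis (- \<omega>) * h z) = cis \<omega> * h (cis \<omega> * h (cis \<omega> * z))"
proof -
  define C where "C = complex_of_real c"
  define w where "w = cis \<omega>"
  have w0: "w \<noteq> 0" by (simp add: w_def)
  have wi: "cis (- \<omega>) = inverse w" by (simp add: w_def cis_inverse)
  have "w + inverse w = of_real (2 * cos \<omega>)"
    by (simp add: w_def cis_inverse complex_eq_iff)
  then have "w + inverse w = 2 * C\<^sup>2" unfolding c_sq[symmetric] C_def by simp
  then have rel: "2 * C\<^sup>2 * w = w * w + 1" using w0 by (simp add: field_simps)
  have nw: "norm w = 1" by (simp add: w_def)
  have n1: "1 - C * z \<noteq> 0" and n2: "1 - C * (w * z) \<noteq> 0"
    and d1: "1 - C * (inverse w * h z) \<noteq> 0" and d2: "1 - C * (w * h (w * z)) \<noteq> 0"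
    unfolding C_def
    by (rule one_minus_c_mult_nonzero, simp add: assms nw norm_mult norm_inverse norm_h)+
  have e1: "h z * (1 - C * z) = C - z" "h (w * z) * (1 - C * (w * z)) = C - w * z"
    using n1 n2 by (simp_all add: h_def C_def)
  \<comment> \<open>\<open>X\<close> and \<open>Y\<close> are the denominators of the two sides once
    the inner fractions are cleared; the goal becomes a polynomial identity modulo
    \<open>rel\<close>.\<close>
  define X where "X = (1 - C * z) * w - C * (C - z)"
  define Y where "Y = (1 - C * (w * z)) - C * w * (C - w * z)"
  have X: "X = (1 - C * (inverse w * h z)) * ((1 - C * z) * w)"
    unfolding X_def e1(1)[symmetric] using w0 by (simp add: field_simps)
  have Y: "Y = (1 - C * (w * h (w * z))) * (1 - C * (w * z))"
    unfolding Y_def e1(2)[symmetric] by (simp add: algebra_simps)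
  have X0: "X \<noteq> 0" using X n1 d1 w0 by simp
  have Y0: "Y \<noteq> 0" using Y n2 d2 by simp
  have L: "h (inverse w * h z) = (C * w * (1 - C * z) - (C - z)) / X"
  proof -
    have "C * w * (1 - C * z) - (C - z) = (C - inverse w * h z) * ((1 - C * z) * w)"
      unfolding e1(1)[symmetric] using w0 by (simp add: field_simps)
    then show ?thesis unfolding X using n1 w0 by (simp add: h_def C_def)
  qed
  have R: "h (w * h (w * z)) = (C * (1 - C * (w * z)) - w * (C - w * z)) / Y"
  proof -
    have "C * (1 - C * (w * z)) - w * (C - w * z) = (C - w * h (w * z)) * (1 - C * (w * z))"
      unfolding e1(2)[symmetric] by (simp add: algebra_simps)
    then show ?thesis unfolding Y using n2 by (simp add: h_def C_def)
  qed
  have "(C * w * (1 - C * z) - (C - z)) * Y = w * (C * (1 - C * (w * z)) - w * (C - w * z)) * X"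
    using rel unfolding X_def Y_def by algebra
  then have "(C * w * (1 - C * z) - (C - z)) / X = w * ((C * (1 - C * (w * z)) - w * (C - w * z)) / Y)"
    using X0 Y0 by (simp add: field_simps)
  then show ?thesis unfolding wi L[symmetric] R[symmetric] w_def[symmetric] .
qed

section \<open>The action of \<open>h\<close> on angles\<close>

text \<open>For angles in \<open>(0, \<pi>)\<close>, \<open>h (cis (-t)) = cis u\<close> iff \<open>G t u = 0\<close> iff
  \<open>tan (t/2) * tan (u/2) = (1-c) / (1+c)\<close>; \<open>\<eta>\<close> solves this for \<open>u\<close>.\<close>

definition G :: "real \<Rightarrow> real \<Rightarrow> real" where
  "G t u = cos ((u + t) / 2) - c * cos ((u - t) / 2)"

definition \<eta> :: "real \<Rightarrow> real" where
  "\<eta> t = 2 * arctan ((1 - c) / (1 + c) / tan (t / 2))"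

text \<open>Both \<open>1 + cis (u - t)\<close> and \<open>cis u + cis (- t)\<close> are real
  multiples of \<open>cis ((u - t) / 2)\<close>, which turns the complex equation into the real one
  \<open>G t u = 0\<close>.\<close>

lemma h_cis_if_G_eq_0:
  assumes "G t u = 0"
  shows "h (cis (- t)) = cis u" "h (cis t) = cis (- u)"
proof -
  have *: "of_real c * (1 + cis (u - t)) = cis u + cis (- t)"
  proof -
    have e: "cis ((u - t) / 2) + cis (- ((u - t) / 2)) = of_real (2 * cos ((u - t) / 2))"
      "cis ((u + t) / 2) + cis (- ((u + t) / 2)) = of_real (2 * cos ((u + t) / 2))"
      by (simp_all add: complex_eq_iff)
    have "1 + cis (u - t) = cis ((u - t) / 2) * of_real (2 * cos ((u - t) / 2))"
      unfolding e(1)[symmetric] distrib_left cis_mult by simp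
    moreover have "cis u + cis (- t) = cis ((u - t) / 2) * of_real (2 * cos ((u + t) / 2))"
      unfolding e(2)[symmetric] distrib_left cis_mult by (simp add: field_simps)
    moreover have "2 * cos ((u + t) / 2) = c * (2 * cos ((u - t) / 2))"
      using assms by (simp add: G_def)
    ultimately show ?thesis by (simp only: of_real_mult mult_ac)
  qed
  have "of_real c - cis (- t) = cis u * (1 - of_real c * cis (- t))"
    using * unfolding right_diff_distrib mult.left_commute[of "cis u"] cis_mult
    by (simp add: algebra_simps)
  then show 1: "h (cis (- t)) = cis u"
    using one_minus_c_mult_nonzero[of "cis (- t)"] by (simp add: h_def)
  have "h (cis t) = cnj (h (cis (- t)))" by (simp add: h_def cis_cnj)
  then show "h (cis t) = cis (- u)" using 1 by (simp add: cis_cnj)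
qed

context
  fixes t :: real
  assumes t: "0 < t" "t < pi"
begin

lemma tan_half_pos: "0 < tan (t / 2)"
  using t by (intro tan_gt_zero) auto

lemma eta_pos: "0 < \<eta> t" and eta_less_pi: "\<eta> t < pi"
  using tan_half_pos c_pos c_less_1 arctan_ubound[of "(1 - c) / (1 + c) / tan (t / 2)"]
  by (auto simp: \<eta>_def)

lemma G_eq:
  assumes "0 < u" "u < pi"
  shows "G t u = (1 + c) * cos (t / 2) * cos (u / 2) * tan (t / 2) * ((1 - c) / (1 + c) / tan (t / 2) - tan (u / 2))"
proof -
  have p: "cos (t / 2) > 0" "cos (u / 2) > 0" using t assms by (auto intro!: cos_gt_zero)
  have "cos ((u + t) / 2) = cos (u / 2) * cos (t / 2) - sin (u / 2) * sin (t / 2)"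
    by (simp add: add_divide_distrib cos_add)
  moreover have "cos ((u - t) / 2) = cos (u / 2) * cos (t / 2) + sin (u / 2) * sin (t / 2)"
    by (simp add: diff_divide_distrib cos_diff)
  moreover have "sin (t / 2) = tan (t / 2) * cos (t / 2)" "sin (u / 2) = tan (u / 2) * cos (u / 2)"
    using p by (simp_all add: tan_def)
  ultimately have "G t u = cos (t / 2) * cos (u / 2) * ((1 - c) - (1 + c) * tan (t / 2) * tan (u / 2))"
    unfolding G_def by (simp add: algebra_simps)
  also have "(1 - c) - (1 + c) * tan (t / 2) * tan (u / 2)
      = (1 + c) * tan (t / 2) * ((1 - c) / (1 + c) / tan (t / 2) - tan (u / 2))"
  proof -
    have "(1 + c) * tan (t / 2) * ((1 - c) / (1 + c) / tan (t / 2)) = 1 - c"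
      using c_pos tan_half_pos by simp
    then show ?thesis unfolding right_diff_distrib[of "(1 + c) * tan (t / 2)"] by linarith
  qed
  finally show ?thesis by (simp add: mult_ac)
qed

text \<open>Bounds on \<open>\<eta>\<close> become sign tests on \<open>G\<close>, which contains
  only cosines: all factors in \<open>G_eq\<close> but the last are positive.\<close>

lemma eta_less_iff: assumes "0 < u" "u < pi" shows "\<eta> t < u \<longleftrightarrow> G t u < 0"
  and less_eta_iff: "u < \<eta> t \<longleftrightarrow> 0 < G t u"
proof -
  have p: "cos (t / 2) > 0" "cos (u / 2) > 0" using t assms by (auto intro!: cos_gt_zero)
  have k: "(1 + c) * cos (t / 2) * cos (u / 2) * tan (t / 2) > 0"
    using p tan_half_pos c_pos by simp
  have u: "u / 2 = arctan (tan (u / 2))" using assms by (simp add: arctan_tan)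
  have "\<eta> t < u \<longleftrightarrow> arctan ((1 - c) / (1 + c) / tan (t / 2)) < arctan (tan (u / 2))"
    unfolding u[symmetric] \<eta>_def by auto
  then show "\<eta> t < u \<longleftrightarrow> G t u < 0"
    unfolding arctan_less_iff G_eq[OF assms] mult_less_0_iff[of "(1 + c) * cos (t / 2) * cos (u / 2) * tan (t / 2)"] using k by linarith
  have "u < \<eta> t \<longleftrightarrow> arctan (tan (u / 2)) < arctan ((1 - c) / (1 + c) / tan (t / 2))"
    unfolding u[symmetric] \<eta>_def by auto
  then show "u < \<eta> t \<longleftrightarrow> 0 < G t u"
    unfolding arctan_less_iff G_eq[OF assms] zero_less_mult_iff[of "(1 + c) * cos (t / 2) * cos (u / 2) * tan (t / 2)"] using k by linarith
qed

lemma eta_eqI: assumes "0 < u" "u < pi" "G t u = 0" shows "\<eta> t = u"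
  using eta_less_iff[OF assms(1,2)] less_eta_iff[OF assms(1,2)] assms(3) by simp

lemma G_eta: "G t (\<eta> t) = 0"
  using eta_less_iff[OF eta_pos eta_less_pi] less_eta_iff[OF eta_pos eta_less_pi] by linarith

end

lemma eta_strict_antimono:
  assumes "0 < t" "t < u" "u < pi" shows "\<eta> u < \<eta> t"
proof -
  have "tan (t / 2) < tan (u / 2)" using assms by (intro tan_monotone) auto
  moreover have "0 < tan (t / 2)" using assms by (intro tan_gt_zero) auto
  ultimately show ?thesis unfolding \<eta>_def
    using c_pos c_less_1 by (auto simp: arctan_less_iff intro!: divide_strict_left_mono)
qed

text \<open>Angular form of T_k(P_k) = Q_(sigma(k)+1).\<close>

lemma eta_b: "\<eta> b = b"
  using b_pos b_less_pi cos_b by (intro eta_eqI) (auto simp: G_def)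

text \<open>Angular form of T_k(Q_k) = Q_(sigma(k)+2).\<close>

lemma eta_omega_minus_b: "\<eta> (\<omega> - b) = \<omega> + b"
proof (rule eta_eqI)
  show "0 < \<omega> - b" "\<omega> - b < pi" "0 < \<omega> + b" "\<omega> + b < pi"
    using b_less_omega omega_le b_pos pi_gt_zero by linarith+
  have "(\<omega> + b - (\<omega> - b)) / 2 = b" "(\<omega> + b + (\<omega> - b)) / 2 = \<omega>" by (simp_all add: field_simps)
  then show "G (\<omega> - b) (\<omega> + b) = 0"
    unfolding G_def using c_sq cos_b by (simp add: power2_eq_square)
qed

text \<open>The first two bounds are the endpoint values carried inwards by antitonicity. The third
  yields \<open>FR s < s\<close> and \<open>s < FL s\<close>; by the sign test it reduces to
  \<open>cos b < cos (\<omega> - t)\<close>.\<close>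

lemma eta_bounds:
  assumes "\<omega> - b < t" "t < b"
  shows "b < \<eta> t" "\<eta> t < \<omega> + b" "\<eta> t < 2 * \<omega> - t"
proof -
  have r: "0 < \<omega> - b" "b < pi" "\<omega> \<le> pi / 6" using b_less_omega b_less_pi omega_le by auto
  show "b < \<eta> t" using eta_strict_antimono[of t b] assms r eta_b by simp
  show "\<eta> t < \<omega> + b" using eta_strict_antimono[of "\<omega> - b" t] assms r eta_omega_minus_b by simp
  have u: "0 < 2 * \<omega> - t" "2 * \<omega> - t < pi" using assms r omega_pos pi_gt_zero b_less_omega by linarith+
  have e: "(2 * \<omega> - t + t) / 2 = \<omega>" "(2 * \<omega> - t - t) / 2 = \<omega> - t" by (simp_all add: field_simps)
  have "cos b < cos (\<omega> - t)"
  proof -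
    have "cos (\<omega> - t) = cos \<bar>\<omega> - t\<bar>" by simp
    also have "\<dots> > cos b" using assms r b_less_omega by (intro cos_monotone_0_pi) auto
    finally show ?thesis .
  qed
  then have "c * c < c * cos (\<omega> - t)" using cos_b c_pos by simp
  then have "G t (2 * \<omega> - t) < 0" unfolding G_def e using c_sq by (simp add: power2_eq_square)
  then show "\<eta> t < 2 * \<omega> - t" using eta_less_iff[of t "2 * \<omega> - t"] assms r u by simp
qed

text \<open>T_k sends the midpoint of (P_k, Q_k) short of P_(sigma(k)+2). This is why a right step
  needs a point in the right half.\<close>

lemma eta_half_omega: "\<eta> (\<omega> / 2) < 2 * \<omega> - b"
proof -
  \<comment> \<open>\<open>D\<close> is the half difference in
    \<open>G (\<omega> / 2) (2 * \<omega> - b)\<close>, and the half sum is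
    \<open>D + \<omega> / 2\<close>. After division by \<open>cos D\<close> the goal reads
    \<open>C - S * tan D < c\<close>; the tangent inequality bounds the left side by
    \<open>5 / 2 * C - 3 / 2\<close>.\<close>
  define D where "D = 3 * \<omega> / 4 - b / 2"
  define C where "C = cos (\<omega> / 2)"
  define S where "S = sin (\<omega> / 2)"
  have C: "9/10 \<le> C" "C < 1" using cos_half_omega_ge cos_half_omega_lt by (auto simp: C_def)
  have S: "S > 0" unfolding S_def using omega_pos omega_le by (intro sin_gt_zero) auto
  have D: "3 * (\<omega> / 8) \<le> D" "D < \<omega>" using b_le b_pos omega_pos by (auto simp: D_def)
  have cD: "cos D > 0" using D omega_pos omega_le by (intro cos_gt_zero) auto
  have "3 / 2 * tan (2 * (\<omega> / 8)) \<le> tan (3 * (\<omega> / 8))"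
    using omega_pos omega_le by (intro tan_three_halves) auto
  also have "\<dots> \<le> tan D"
    using D omega_pos omega_le by (intro tan_mono_le) auto
  also have "2 * (\<omega> / 8) = \<omega> / 4" by simp
  also have "tan (\<omega> / 4) = (1 - C) / S"
  proof -
    have "cos (\<omega> / 4) > 0" "sin (\<omega> / 4) > 0" using omega_pos omega_le
      by (auto intro!: cos_gt_zero sin_gt_zero)
    moreover have "C = 1 - 2 * (sin (\<omega> / 4))\<^sup>2" "S = 2 * sin (\<omega> / 4) * cos (\<omega> / 4)"
      using cos_double_sin[of "\<omega> / 4"] sin_double[of "\<omega> / 4"] by (simp_all add: C_def S_def)
    ultimately show ?thesis by (simp add: tan_def field_simps power2_eq_square)
  qed
  finally have "3 / 2 * (1 - C) \<le> tan D * S" using S by (simp add: field_simps)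
  then have "3 / 2 * (1 - C) * cos D \<le> tan D * S * cos D" using cD by (intro mult_right_mono) auto
  also have "\<dots> = sin D * S" using cD by (simp add: tan_def)
  finally have sD: "3 / 2 * (1 - C) * cos D \<le> sin D * S" .
  have "(5 / 2 * C - 3 / 2)\<^sup>2 < c\<^sup>2"
  proof -
    have "(1 - C) * (17 * C - 13) > 0" using C by (intro mult_pos_pos) auto
    then show ?thesis unfolding c_sq cos_omega C_def[symmetric] by (simp add: power2_eq_square algebra_simps)
  qed
  then have "5 / 2 * C - 3 / 2 < c" by (rule power2_less_imp_less) (use c_pos in auto)
  then have "(5 / 2 * C - 3 / 2) * cos D < c * cos D" using cD by simp
  moreover have "cos (D + \<omega> / 2) = cos D * C - sin D * S" by (simp add: cos_add C_def S_def)
  ultimately have "cos (D + \<omega> / 2) < c * cos D" using sD by (simp add: algebra_simps)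
  moreover have "(2 * \<omega> - b + \<omega> / 2) / 2 = D + \<omega> / 2" "(2 * \<omega> - b - \<omega> / 2) / 2 = D"
    by (simp_all add: D_def field_simps)
  ultimately have "G (\<omega> / 2) (2 * \<omega> - b) < 0" unfolding G_def by (simp only: diff_less_0_iff_less)
  then show ?thesis
    using eta_less_iff[of "\<omega> / 2" "2 * \<omega> - b"] omega_pos omega_le b_less_omega b_pos by simp
qed

lemma less_half_omega_if_eta_greater:
  assumes "\<omega> - b < t" "t < b" "2 * \<omega> - b < \<eta> t"
  shows "t < \<omega> / 2"
proof (rule ccontr)
  assume "\<not> t < \<omega> / 2"
  then consider "t = \<omega> / 2" | "\<omega> / 2 < t" by linarith
  then have "\<eta> t \<le> \<eta> (\<omega> / 2)"
  proof cases
    case 2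
    then show ?thesis
      using eta_strict_antimono[of "\<omega> / 2" t] assms b_less_pi omega_pos by auto
  qed (simp only: order_refl)
  then show False using eta_half_omega assms by linarith
qed

end

section \<open>The partition lifted to the real line\<close>

locale boundary_partition = regular_polygon +
  fixes A :: "int \<Rightarrow> complex"
  assumes A_periodic: "A (i + NN g) = A i"
    and A_in_arc: "A i \<in> arc_oo (Pt g i) (Qt g i)"
begin

definition \<alpha> :: "int \<Rightarrow> real" where "\<alpha> i = Arg (A i * cis (- (of_int i * \<omega>)))"

lemma A_cong: assumes "[i = j] (mod N)" shows "A i = A j"
proof -
  have nat: "A (i + N * int n) = A i" for i n
  proof (induction n)
    case (Suc n)
    have "A (i + N * int (Suc n)) = A (i + N * int n + N)" by (simp add: algebra_simps)
    then show ?case using Suc A_periodic by simp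
  qed simp
  obtain n where n: "i = j + N * n" using assms by (metis cong_iff_lin cong_sym)
  show ?thesis
  proof (cases "n \<ge> 0")
    case True
    then show ?thesis using nat[of j "nat n"] n by simp
  next
    case False
    then show ?thesis using nat[of i "nat (- n)"] n by simp
  qed
qed

lemma alpha_cong: assumes "[i = j] (mod N)" shows "\<alpha> i = \<alpha> j"
proof -
  have "cis (of_int (- i) * \<omega> + 0) = cis (of_int (- j) * \<omega> + 0)"
    using assms by (intro cis_cong) (simp add: cong_minus_minus_iff)
  then show ?thesis unfolding \<alpha>_def A_cong[OF assms] by simp
qed

lemma A_eq: "A i = cis (of_int i * \<omega> + \<alpha> i)"
  and alpha_gt: "- b < \<alpha> i" and alpha_lt: "\<alpha> i < b - \<omega>"
proof -
  have "Pt g i = cis (of_int i * \<omega> - b)" "Qt g i = cis (of_int i * \<omega> + (b - \<omega>))"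
    by (simp_all add: Pt_def Qt_def \<omega>_def algebra_simps diff_divide_distrib)
  then obtain x where x: "of_int i * \<omega> - b < x" "x < of_int i * \<omega> + (b - \<omega>)" "A i = cis x"
    using arc_oo_cisD[of "A i" "of_int i * \<omega> - b" "of_int i * \<omega> + (b - \<omega>)"]
      A_in_arc[of i] half_omega_less_b b_less_omega omega_le pi_gt_zero by auto
  have "Arg (cis (x - of_int i * \<omega>)) = x - of_int i * \<omega>"
    using x b_less_pi omega_pos b_less_omega omega_le by (intro Arg_cis) auto
  then have "\<alpha> i = x - of_int i * \<omega>" by (simp add: \<alpha>_def x(3) cis_mult)
  then show "A i = cis (of_int i * \<omega> + \<alpha> i)" "- b < \<alpha> i" "\<alpha> i < b - \<omega>"
    using x by auto
qed

text \<open>A lift of the partition points, increasing over all integers. A full turn is a shift of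
  the index by \<open>N\<close>, so locating a point needs no wrap-around cases.\<close>

definition a :: "int \<Rightarrow> real" where "a i = of_int i * \<omega> + \<alpha> i"

lemma a_step: "a i < a (i + 1)" "a (i + 1) < a i + 2 * pi"
  using alpha_gt[of i] alpha_lt[of i] alpha_gt[of "i + 1"] alpha_lt[of "i + 1"]
    b_less_omega omega_pos omega_le pi_gt_zero
  by (auto simp: a_def algebra_simps)

lemma a_strict_mono: "i < j \<Longrightarrow> a i < a j"
  by (induction j rule: int_gr_induct) (use a_step(1) less_trans in blast)+

lemma a_mono: "i \<le> j \<Longrightarrow> a i \<le> a j"
  using a_strict_mono by (cases "i = j") (auto intro: less_imp_le)

lemma a_shift: "a (i + N * n) = a i + 2 * pi * of_int n"
proof -
  have "\<alpha> (i + N * n) = \<alpha> i" by (rule alpha_cong) (simp add: cong_def)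
  then show ?thesis using N_omega by (simp add: a_def algebra_simps)
qed

text \<open>Evaluates the definite descriptions in \<open>fmap\<close> and
  \<open>fmap_lower\<close>, whose conditions hold on exactly one residue class.\<close>

lemma the_index:
  assumes "\<And>i. Q i \<longleftrightarrow> (\<exists>n. i = j + N * n)"
  shows "(THE i. 0 \<le> i \<and> i < N \<and> Q i) = j mod N"
proof (rule the_equality)
  have "j mod N = j + N * (- (j div N))"
    by (simp add: minus_mult_div_eq_mod)
  then have "Q (j mod N)" using assms by blast
  then show "0 \<le> j mod N \<and> j mod N < N \<and> Q (j mod N)" using N_ge by simp
next
  fix i assume "0 \<le> i \<and> i < N \<and> Q i"
  then show "i = j mod N"
    using assms mod_pos_pos_trivial[of i N] by (metis mod_mult_self2)
qed

lemma fmap_cis: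
  assumes "a j \<le> x" "x < a (j + 1)"
  shows "fmap g A (cis x) = Tgen g j (cis x)"
proof -
  have mem: "cis x \<in> arc_co (A i) (A (i + 1)) \<longleftrightarrow> (\<exists>n. i = j + N * n)" for i
  proof -
    have "cis x \<in> arc_co (A i) (A (i + 1)) \<longleftrightarrow>
        (\<exists>n::int. a i \<le> x + 2 * pi * of_int n \<and> x + 2 * pi * of_int n < a (i + 1))"
      using arc_co_cis_iff[OF a_step] by (simp add: A_eq a_def)
    also have "\<dots> \<longleftrightarrow> (\<exists>n. i = j + N * n)"
    proof (intro iff_exI iffI)
      fix n assume n: "a i \<le> x + 2 * pi * of_int n \<and> x + 2 * pi * of_int n < a (i + 1)"
      have "a i < a (j + 1 + N * n)" "a (j + N * n) < a (i + 1)"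
        using n assms unfolding a_shift by linarith+
      then have "i < j + 1 + N * n" "j + N * n < i + 1"
        using a_mono by (meson not_less)+
      then show "i = j + N * n" by linarith
    next
      fix n assume n: "i = j + N * n"
      have "a i = a j + 2 * pi * of_int n" "a (i + 1) = a (j + 1) + 2 * pi * of_int n"
        using a_shift[of j n] a_shift[of "j + 1" n] by (simp_all add: n algebra_simps)
      then show "a i \<le> x + 2 * pi * of_int n \<and> x + 2 * pi * of_int n < a (i + 1)"
        using assms by simp
    qed
    finally show ?thesis .
  qed
  show ?thesis unfolding fmap_def the_index[OF mem] by (simp add: Tgen_cong[of "j mod N" j] cong_def)
qed

lemma fmap_lower_cis:
  assumes "a j < x" "x \<le> a (j + 1)"
  shows "fmap_lower g A (cis x) = Tgen g j (cis x)"
proof -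
  have mem: "cis x \<in> arc_oc (A i) (A (i + 1)) \<longleftrightarrow> (\<exists>n. i = j + N * n)" for i
  proof -
    have "cis x \<in> arc_oc (A i) (A (i + 1)) \<longleftrightarrow>
        (\<exists>n::int. a i < x + 2 * pi * of_int n \<and> x + 2 * pi * of_int n \<le> a (i + 1))"
      using arc_oc_cis_iff[OF a_step] by (simp add: A_eq a_def)
    also have "\<dots> \<longleftrightarrow> (\<exists>n. i = j + N * n)"
    proof (intro iff_exI iffI)
      fix n assume n: "a i < x + 2 * pi * of_int n \<and> x + 2 * pi * of_int n \<le> a (i + 1)"
      have "a i < a (j + 1 + N * n)" "a (j + N * n) < a (i + 1)"
        using n assms unfolding a_shift by linarith+
      then have "i < j + 1 + N * n" "j + N * n < i + 1"
        using a_mono by (meson not_less)+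
      then show "i = j + N * n" by linarith
    next
      fix n assume n: "i = j + N * n"
      have "a i = a j + 2 * pi * of_int n" "a (i + 1) = a (j + 1) + 2 * pi * of_int n"
        using a_shift[of j n] a_shift[of "j + 1" n] by (simp_all add: n algebra_simps)
      then show "a i < x + 2 * pi * of_int n \<and> x + 2 * pi * of_int n \<le> a (i + 1)"
        using assms by simp
    qed
    finally show ?thesis .
  qed
  show ?thesis unfolding fmap_lower_def the_index[OF mem] by (simp add: Tgen_cong[of "j mod N" j] cong_def)
qed

section \<open>One step of the two orbits\<close>

text \<open>A point of \<open>(P\<^sub>k, Q\<^sub>k)\<close> is written \<open>cis (k * \<omega> + s)\<close> with \<open>s \<in> I\<close>; then \<open>Up k s\<close> has
  coordinate \<open>FR s\<close> relative to index \<open>r k\<close>, and \<open>Lo k s\<close> has coordinate \<open>FL s\<close> relative to \<open>l k\<close>.\<close>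

definition r :: "int \<Rightarrow> int" where "r k = sg k + 2"

definition l :: "int \<Rightarrow> int" where "l k = sg (k - 1) - 1"

definition FR :: "real \<Rightarrow> real" where "FR s = \<eta> (- s) - 2 * \<omega>"

text \<open>This is \<open>FR\<close> conjugated by the reflection
  \<open>s \<mapsto> - \<omega> - s\<close>, which swaps the halves of \<open>I\<close>.\<close>

definition FL :: "real \<Rightarrow> real" where "FL s = \<omega> - \<eta> (\<omega> + s)"

definition Up :: "int \<Rightarrow> real \<Rightarrow> complex" where "Up k s = Tgen g k (cis (of_int k * \<omega> + s))"

definition Lo :: "int \<Rightarrow> real \<Rightarrow> complex" where "Lo k s = Tgen g (k - 1) (cis (of_int k * \<omega> + s))"

definition I :: "real set" where "I = {- b <..< b - \<omega>}"

definition merges :: "int \<Rightarrow> real \<Rightarrow> bool" where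
  "merges k s \<longleftrightarrow> (\<exists>m n :: nat. 0 < m \<and> 0 < n \<and> (fmap g A ^^ m) (Up k s) = (fmap_lower g A ^^ n) (Lo k s))"

lemma Up_eq_rotated: "Up k s = cis (of_int (sg k) * \<omega>) * h (cis s)"
  using Tgen_rotated[of "cis s" k] by (simp add: Up_def cis_mult)

lemma Lo_eq_rotated: "Lo k s = cis (of_int (sg (k - 1)) * \<omega>) * h (cis \<omega> * cis s)"
  using Tgen_rotated[of "cis \<omega> * cis s" "k - 1"]
  by (simp add: Lo_def cis_mult norm_mult algebra_simps)

lemma Up_eq: assumes "s \<in> I" shows "Up k s = cis (of_int (r k) * \<omega> + FR s)"
proof -
  have "h (cis (- (- s))) = cis (\<eta> (- s))"
    using assms b_less_omega b_less_pi by (intro h_cis_if_G_eq_0 G_eta) (auto simp: I_def)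
  then show ?thesis by (simp add: Up_eq_rotated cis_mult r_def FR_def algebra_simps)
qed

lemma Lo_eq: assumes "s \<in> I" shows "Lo k s = cis (of_int (l k) * \<omega> + FL s)"
proof -
  have "h (cis (\<omega> + s)) = cis (- \<eta> (\<omega> + s))"
    using assms b_less_omega b_less_pi by (intro h_cis_if_G_eq_0 G_eta) (auto simp: I_def)
  then show ?thesis by (simp add: Lo_eq_rotated cis_mult l_def FL_def algebra_simps)
qed

lemma FR_bounds: assumes "s \<in> I"
  shows "b - 2 * \<omega> < FR s" "FR s < b - \<omega>" "FR s < s" "- b < FR s \<Longrightarrow> - \<omega> / 2 < s"
  using assms eta_bounds[of "- s"] less_half_omega_if_eta_greater[of "- s"] by (auto simp: FR_def I_def)

lemma FL_bounds: assumes "s \<in> I"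
  shows "- b < FL s" "FL s < \<omega> - b" "s < FL s" "FL s < b - \<omega> \<Longrightarrow> s < - \<omega> / 2"
  using assms eta_bounds[of "\<omega> + s"] less_half_omega_if_eta_greater[of "\<omega> + s"] by (auto simp: FL_def I_def)

text \<open>Through \<open>Tgen_rotated\<close> this becomes \<open>h_relation\<close> at
  \<open>z = cis s\<close>; the remaining rotations agree only modulo \<open>N\<close>.\<close>

lemma cycle_relation: "Tgen g (r k - 1) (Up k s) = Tgen g (l k) (Lo k s)"
proof -
  have "Up k s = cis (of_int (r k - 1) * \<omega>) * (cis (- \<omega>) * h (cis s))"
    unfolding Up_eq_rotated r_def mult.assoc[symmetric] cis_mult by (simp add: algebra_simps)
  then have U: "Tgen g (r k - 1) (Up k s) = cis (of_int (sg (r k - 1)) * \<omega>) * h (cis (- \<omega>) * h (cis s))"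
    using Tgen_rotated[of "cis (- \<omega>) * h (cis s)"] by (simp only: norm_mult norm_h norm_cis mult_1_left)
  have "Lo k s = cis (of_int (l k) * \<omega>) * (cis \<omega> * h (cis \<omega> * cis s))"
    unfolding Lo_eq_rotated l_def mult.assoc[symmetric] cis_mult by (simp add: algebra_simps)
  then have L: "Tgen g (l k) (Lo k s) = cis (of_int (sg (l k)) * \<omega>) * h (cis \<omega> * h (cis \<omega> * cis s))"
    using Tgen_rotated[of "cis \<omega> * h (cis \<omega> * cis s)"] by (simp only: norm_mult norm_h norm_cis mult_1_left)
  have "[sg (l k) = sg (r k - 1) + 1] (mod N)"
  proof (cases "odd k")
    case True
    then have "sg (l k) = sg (r k - 1) + 1 + N" by (auto simp: sg_def l_def r_def NN_def)
    then show ?thesis by (simp add: cong_def)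
  next
    case False
    then have "sg (l k) + N = sg (r k - 1) + 1" by (auto simp: sg_def l_def r_def NN_def)
    then show ?thesis by (metis cong_def mod_add_self2)
  qed
  from cis_cong[OF this, of 0] show ?thesis
    unfolding U L h_relation[OF norm_cis] by (simp add: mult.assoc[symmetric] cis_mult algebra_simps)
qed

text \<open>The point lies between Q_(r k - 1) and Q_(r k), so only the partition point of index
  \<open>r k\<close> can separate the cases.\<close>

lemma fmap_Up:
  assumes "s \<in> I"
  shows "fmap g A (Up k s) = Tgen g (if \<alpha> (r k) \<le> FR s then r k else r k - 1) (Up k s)"
proof -
  note bds = FR_bounds[OF assms] alpha_lt[of "r k - 1"] alpha_gt[of "r k + 1"] b_less_omega
  show ?thesis
  proof (cases "\<alpha> (r k) \<le> FR s")
    case True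
    then have "fmap g A (Up k s) = Tgen g (r k) (Up k s)"
      unfolding Up_eq[OF assms] using bds by (intro fmap_cis) (auto simp: a_def algebra_simps)
    then show ?thesis using True by simp
  next
    case False
    then have "fmap g A (Up k s) = Tgen g (r k - 1) (Up k s)"
      unfolding Up_eq[OF assms] using bds by (intro fmap_cis) (auto simp: a_def algebra_simps)
    then show ?thesis using False by simp
  qed
qed

text \<open>Here the point lies between P_(l k) and P_(l k + 1). Equality selects the lower index,
  as the convention for this orbit demands.\<close>

lemma fmap_lower_Lo:
  assumes "s \<in> I"
  shows "fmap_lower g A (Lo k s) = Tgen g (if FL s \<le> \<alpha> (l k) then l k - 1 else l k) (Lo k s)"
proof -
  note bds = FL_bounds[OF assms] alpha_lt[of "l k - 1"] alpha_gt[of "l k + 1"] b_less_omega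
  show ?thesis
  proof (cases "FL s \<le> \<alpha> (l k)")
    case True
    then have "fmap_lower g A (Lo k s) = Tgen g (l k - 1) (Lo k s)"
      unfolding Lo_eq[OF assms] using bds by (intro fmap_lower_cis) (auto simp: a_def algebra_simps)
    then show ?thesis using True by simp
  next
    case False
    then have "fmap_lower g A (Lo k s) = Tgen g (l k) (Lo k s)"
      unfolding Lo_eq[OF assms] using bds by (intro fmap_lower_cis) (auto simp: a_def algebra_simps)
    then show ?thesis using False by simp
  qed
qed

lemma mergesI_step:
  assumes "merges k' s'" "fmap g A (Up k s) = Up k' s'" "fmap_lower g A (Lo k s) = Lo k' s'"
  shows "merges k s"
proof -
  from assms(1) obtain m n :: nat where "(fmap g A ^^ m) (Up k' s') = (fmap_lower g A ^^ n) (Lo k' s')"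
    unfolding merges_def by blast
  then have "(fmap g A ^^ Suc m) (Up k s) = (fmap_lower g A ^^ Suc n) (Lo k s)"
    using assms(2,3) by (simp add: funpow_swap1)
  then show ?thesis unfolding merges_def by blast
qed

lemma not_merges_cases:
  assumes "s \<in> I" "\<not> merges k s"
  obtains (right) "\<alpha> (r k) \<le> FR s" "\<not> merges (r k) (FR s)" "FR s \<in> I" "- \<omega> / 2 < s"
    | (left) "FL s \<le> \<alpha> (l k)" "\<not> merges (l k) (FL s)" "FL s \<in> I" "s < - \<omega> / 2"
proof -
  note R = FR_bounds[OF assms(1)] and L = FL_bounds[OF assms(1)]
  consider "\<alpha> (r k) \<le> FR s" | "\<not> \<alpha> (r k) \<le> FR s" "FL s \<le> \<alpha> (l k)"
    | "\<not> \<alpha> (r k) \<le> FR s" "\<not> FL s \<le> \<alpha> (l k)" by blast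
  then show ?thesis
  proof cases
    case 1
    then have s: "FR s \<in> I" "- \<omega> / 2 < s" using R alpha_gt[of "r k"] by (auto simp: I_def)
    \<comment> \<open>A simultaneous left condition would put \<open>s\<close> below
      \<open>- \<omega> / 2\<close> by \<open>FL_bounds\<close>.\<close>
    then have nl: "\<not> FL s \<le> \<alpha> (l k)" using L(4) alpha_lt[of "l k"] by force
    have "fmap g A (Up k s) = Up (r k) (FR s)"
      using 1 by (simp add: fmap_Up[OF assms(1)] Up_def[of "r k"] flip: Up_eq[OF assms(1)])
    \<comment> \<open>The lower orbit applies the generator \<open>l k\<close>; by
      \<open>cycle_relation\<close> the result is generator \<open>r k - 1\<close> applied to
      \<open>Up k s\<close>, so both orbits again come from one point.\<close>
    moreover have "fmap_lower g A (Lo k s) = Lo (r k) (FR s)"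
      using nl by (simp add: fmap_lower_Lo[OF assms(1)] Lo_def[of "r k"] flip: cycle_relation Up_eq[OF assms(1)])
    ultimately show ?thesis using right 1 s mergesI_step assms(2) by blast
  next
    case 2
    then have s: "FL s \<in> I" "s < - \<omega> / 2" using L alpha_lt[of "l k"] by (auto simp: I_def)
    have "fmap g A (Up k s) = Up (l k) (FL s)"
      using 2 by (simp add: fmap_Up[OF assms(1)] cycle_relation Up_def[of "l k"] flip: Lo_eq[OF assms(1)])
    moreover have "fmap_lower g A (Lo k s) = Lo (l k) (FL s)"
      using 2 by (simp add: fmap_lower_Lo[OF assms(1)] Lo_def[of "l k"] flip: Lo_eq[OF assms(1)])
    ultimately show ?thesis using left 2 s mergesI_step assms(2) by blast
  next
    case 3
    then have "(fmap g A ^^ 1) (Up k s) = (fmap_lower g A ^^ 1) (Lo k s)"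
      by (simp add: fmap_Up[OF assms(1)] fmap_lower_Lo[OF assms(1)] cycle_relation)
    then show ?thesis using assms(2) unfolding merges_def by (metis zero_less_one)
  qed
qed

section \<open>Alternation of steps and the clash of indices\<close>

lemma r_r: "r (r k) = k" and l_l: "l (l k) = k"
  by (auto simp: r_def l_def sg_def)

text \<open>\<open>DR k\<close>: a non-merging pair at index \<open>k\<close>, initial or reached by a left step, is about to make a
  right step; \<open>DL k\<close> is the mirror image.\<close>

definition DR :: "int \<Rightarrow> bool" where
  "DR k \<longleftrightarrow> (\<exists>s\<in>I. s \<le> \<alpha> k \<and> - \<omega> / 2 < s \<and> \<not> merges k s)"

definition DL :: "int \<Rightarrow> bool" where
  "DL k \<longleftrightarrow> (\<exists>s\<in>I. \<alpha> k \<le> s \<and> s < - \<omega> / 2 \<and> \<not> merges k s)"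

lemma DR_imp_DL: assumes "DR k" shows "DL (r k)"
proof -
  obtain s where s: "s \<in> I" "s \<le> \<alpha> k" "- \<omega> / 2 < s" "\<not> merges k s" using assms by (auto simp: DR_def)
  from s(1,4) show ?thesis
  proof (cases rule: not_merges_cases)
    case right
    from right(3,2) show ?thesis
    proof (cases rule: not_merges_cases)
      case R2: right
      \<comment> \<open>A second right step is back at index \<open>k\<close>, with
        \<open>\<alpha> k \<le> FR (FR s) < FR s < s\<close>.\<close>
      then show ?thesis using FR_bounds(3)[OF s(1)] FR_bounds(3)[OF right(3)] s by (simp add: r_r)
    next
      case left
      then show ?thesis using right by (auto simp: DL_def)
    qed
  qed (use s in auto)
qed

lemma DL_imp_DR: assumes "DL k" shows "DR (l k)"
proof -
  obtain s where s: "s \<in> I" "\<alpha> k \<le> s" "s < - \<omega> / 2" "\<not> merges k s" using assms by (auto simp: DL_def)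
  from s(1,4) show ?thesis
  proof (cases rule: not_merges_cases)
    case left
    from left(3,2) show ?thesis
    proof (cases rule: not_merges_cases)
      case L2: left
      then show ?thesis using FL_bounds(3)[OF s(1)] FL_bounds(3)[OF left(3)] s by (simp add: l_l)
    next
      case right
      then show ?thesis using left by (auto simp: DR_def)
    qed
  qed (use s in auto)
qed

lemma DR_DL_incompatible: "DR k \<Longrightarrow> DL k' \<Longrightarrow> [k = k'] (mod N) \<Longrightarrow> False"
  using alpha_cong[of k k'] by (auto simp: DR_def DL_def)

lemma not_DR: "\<not> DR k"
proof
  assume D: "DR k"
  \<comment> \<open>On indices of the parity of \<open>k\<close>, a right step followed by a left
    step is translation by the even number \<open>d\<close>.\<close>
  define d where "d = (if odd k then - 4 * int g else 4 * int g - 4)"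
  have "even d" by (simp add: d_def)
  have DRn: "DR (k + d * int n)" for n
  proof (induction n)
    case (Suc n)
    have "l (r (k + d * int n)) = k + d * int (Suc n)"
      using \<open>even d\<close> by (cases "odd k") (auto simp: l_def r_def sg_def d_def algebra_simps)
    then show ?case using DL_imp_DR[OF DR_imp_DL[OF Suc]] by simp
  qed (use D in simp)
  \<comment> \<open>In steps of 4, \<open>d\<close> is \<open>-g\<close> or \<open>g-1\<close>, with inverses \<open>-2\<close> mod \<open>2g-1\<close>; \<open>e\<close> solves
    \<open>r (k + d * e) = k\<close> mod \<open>N\<close>.\<close>
  define e where "e = (if odd k then k - 1 - 2 * int g else k - 2)"
  have "even e" by (simp add: e_def)
  then obtain f where f: "e = 2 * f" by blast
  \<comment> \<open>A natural number congruent to \<open>e\<close> modulo \<open>N\<close>, since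
    \<open>DRn\<close> iterates only forwards.\<close>
  define n where "n = nat (e + N * \<bar>e\<bar>)"
  have "1 * \<bar>e\<bar> \<le> N * \<bar>e\<bar>" using N_ge by (intro mult_right_mono) auto
  then have n: "int n = e + N * \<bar>e\<bar>" unfolding n_def by simp
  have "[r (k + d * e) = k] (mod N)"
  proof (cases "odd k")
    case True
    then have "r (k + d * e) = k + N * f" using \<open>even d\<close> f
      by (auto simp: r_def sg_def d_def e_def NN_def algebra_simps)
    then show ?thesis by (simp add: cong_def)
  next
    case False
    then have "r (k + d * e) = k + N * (- f)" using \<open>even d\<close> f
      by (auto simp: r_def sg_def d_def e_def NN_def algebra_simps)
    then show ?thesis by (metis cong_def mod_mult_self2)
  qed
  moreover have "r (k + d * int n) = r (k + d * e) + N * (- d * \<bar>e\<bar>)"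
    using \<open>even d\<close> by (auto simp: n r_def sg_def algebra_simps)
  ultimately have "[k = r (k + d * int n)] (mod N)"
    by (metis cong_def mod_mult_self2)
  then show False using DR_DL_incompatible D DR_imp_DL[OF DRn] by blast
qed

lemma merges_alpha: "merges k (\<alpha> k)"
proof (rule ccontr)
  assume nm: "\<not> merges k (\<alpha> k)"
  have I: "\<alpha> k \<in> I" using alpha_gt alpha_lt by (simp add: I_def)
  \<comment> \<open>The initial coordinate equals \<open>\<alpha> k\<close>, so it meets the
    ordering conditions of both \<open>DR\<close> and \<open>DL\<close>; the first step decides
    which one applies.\<close>
  from I nm show False
  proof (cases rule: not_merges_cases)
    case right
    then have "DR k" using I nm by (auto simp: DR_def)
    then show False using not_DR by simp
  next
    case left
    then have "DL k" using I nm by (auto simp: DL_def)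
    then show False using not_DR DL_imp_DR by blast
  qed
qed

end

theorem theorem1p1:
  fixes g :: nat and A :: "int \<Rightarrow> complex"
  assumes "g \<ge> 2"
    and "\<forall>i. A (i + NN g) = A i"
    and "\<forall>i. A i \<in> arc_oo (Pt g i) (Qt g i)"
  shows "\<forall>i. 1 \<le> i \<and> i \<le> NN g \<longrightarrow>
           (\<exists>m k :: nat. 0 < m \<and> 0 < k \<and>
              (fmap g A ^^ m) (Tgen g i (A i)) = (fmap_lower g A ^^ k) (Tgen g (i - 1) (A i)))"
proof -
  interpret boundary_partition g A
    using assms by unfold_locales auto
  show ?thesis
    using merges_alpha unfolding merges_def Up_def Lo_def A_eq[symmetric] by blast
qed

end
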